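(* Let $d\ge 1$ and let $A$ and $B$ be (possibly infinite) sets of points in $\mathbb{R}^d$, each of which affinely spans $\mathbb{R}^d$. If $\gamma\colon A\to B$ is an order-type reversing bijection, then there exists an affine hyperplane in $\mathbb{R}^d$ which intersects, for every $a\in A$, the segment $ab$ with endpoints $a$ and $b=\gamma(a)$.
   Context: A bijection $\gamma\colon A\to B$ between subsets of $\mathbb{R}^d$ is order-type reversing if $$\operatorname{sgn}\det\begin{bmatrix} a_0 & a_1 & \cdots & a_d\\ 1 & 1 & \cdots & 1\end{bmatrix} = -\operatorname{sgn}\det\begin{bmatrix} \gamma(a_0) & \gamma(a_1) & \cdots & \gamma(a_d)\\ 1 & 1 & \cdots & 1\end{bmatrix}$$ for all $(d+1)$-tuples $(a_0,a_1,\dots,a_d)\in A^{d+1}$ with distinct entries. Here $\operatorname{sgn}$ takes values in $\{+,-,0\}$ (so zero determinants correspond to zero determinants). The segment $ab$ is the closed segment, i.e. the convex hull of $\{a,b\}$ (a single point if $a=b$). *)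

theory Defs
  imports "HOL-Analysis.Analysis"
begin

text \<open>
  Points of $\mathbb{R}^d$ are vectors of type \<open>real ^ 'd\<close>, where $d$ is the cardinality of
  \<open>'d\<close> (so $d \ge 1$). The \<open>d + 1\<close> row and column indices of the homogeneous coordinate matrix
  are the elements of \<open>'d option\<close>: column \<open>j\<close> is the point \<open>a j\<close>, row \<open>Some i\<close> holds the
  \<open>i\<close>-th coordinates, and row \<open>None\<close> is the row of ones. Identifying \<open>'d option\<close> with
  $\{0, \dots, d\}$ in another way, separately for rows and columns, changes the determinant
  only by a global sign, which is the same for all tuples.
\<close>

definition homog_matrix :: "('d::finite option \<Rightarrow> real ^ 'd) \<Rightarrow> real ^ 'd option ^ 'd option" where
  "homog_matrix a = (\<chi> i j. case i of None \<Rightarrow> 1 | Some k \<Rightarrow> a j $ k)"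

text \<open>Injective families \<open>a\<close> are the \<open>(d + 1)\<close>-tuples with distinct entries.\<close>

definition order_type_reversing ::
  "(real ^ 'd::finite) set \<Rightarrow> (real ^ 'd) set \<Rightarrow> (real ^ 'd \<Rightarrow> real ^ 'd) \<Rightarrow> bool" where
  "order_type_reversing A B \<gamma> \<longleftrightarrow>
     bij_betw \<gamma> A B \<and>
     (\<forall>a :: 'd option \<Rightarrow> real ^ 'd. (\<forall>j. a j \<in> A) \<and> inj a \<longrightarrow>
        sgn (det (homog_matrix a)) = - sgn (det (homog_matrix (\<lambda>j. \<gamma> (a j)))))"

definition affine_hyperplane :: "(real ^ 'd::finite) set \<Rightarrow> bool" where
  "affine_hyperplane H \<longleftrightarrow> (\<exists>n c. n \<noteq> 0 \<and> H = {x. n \<bullet> x = c})"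

end

theory Submission
  imports Defs "HOL-Homology.Brouwer_Degree"
begin

text \<open>
  Write \<open>u a\<close> and \<open>v a\<close> for the homogeneous coordinates \<open>(a, 1)\<close> and \<open>(\<gamma> a, 1)\<close>. A hyperplane
  meeting all segments is a unit vector \<open>x\<close> with \<open>(u a \<bullet> x) * (v a \<bullet> x) \<le> 0\<close> for all \<open>a\<close>; by
  compactness of the sphere it suffices to find one for every finite subset of \<open>A\<close> that affinely
  spans the space.
  By Cauchy-Binet and the hypothesis on signs, every matrix \<open>M d = (\<Sum>a. d a * u a * (v a)\<^sup>T)\<close>
  with positive weights \<open>d\<close> has negative determinant. If there were no such \<open>x\<close>, then with the
  weights \<open>q a x = max 0 ((u a \<bullet> x) * (v a \<bullet> x))\<close> the map \<open>G x = M (q x) *v x\<close> would satisfy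
  \<open>x \<bullet> G x > 0\<close> on the sphere. Straight-line homotopies avoiding the origin then connect \<open>G\<close> both
  to the identity and to the linear map \<open>M 1\<close>. But a linear map of negative determinant is
  homotopic to a reflection, which has degree \<open>-1\<close>.
\<close>

subsection \<open>Cauchy-Binet\<close>

text \<open>Multilinearity in the rows gives a sum over index functions \<open>f\<close> whose
  \<open>u\<close>-factor is only a diagonal product. Averaging over all permutations of the indices
  completes it to a determinant. Summing over functions instead of subsets of size
  \<open>CARD('n)\<close> avoids ordering \<open>F\<close> and accounts for the factorial.\<close>

lemma cauchy_binet_sum:
  fixes u v :: "'a \<Rightarrow> real ^ 'n::finite"
  assumes "finite F"
  shows "fact CARD('n) * det (\<chi> i j. \<Sum>a\<in>F. u a $ i * v a $ j) =
    (\<Sum>f | \<forall>i. f i \<in> F. det (\<chi> i. u (f i)) * det (\<chi> i. v (f i)))"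
proof -
  let ?P = "{p. p permutes (UNIV :: 'n set)}" and ?\<F> = "{f :: 'n \<Rightarrow> 'a. \<forall>i. f i \<in> F}"
  let ?D = "det (\<chi> i j. \<Sum>a\<in>F. u a $ i * v a $ j)"
  have expand: "?D = (\<Sum>f\<in>?\<F>. (\<Prod>i\<in>UNIV. u (f i) $ i) * det (\<chi> i. v (f i)))"
  proof -
    have "?D = (\<Sum>p\<in>?P. of_int (sign p) * (\<Sum>f\<in>?\<F>. \<Prod>i\<in>UNIV. u (f i) $ i * v (f i) $ p i))"
      unfolding det_def using assms by (simp add: prod_sum_PiE PiE_UNIV_domain Pi_def)
    also have "\<dots> = (\<Sum>f\<in>?\<F>. (\<Prod>i\<in>UNIV. u (f i) $ i) * det (\<chi> i. v (f i)))"
      unfolding sum_distrib_left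
      by (subst sum.swap) (simp add: det_def prod.distrib sum_distrib_left mult_ac)
    finally show ?thesis .
  qed
  \<comment> \<open>Substituting \<open>f \<circ> p\<close> for \<open>f\<close> leaves the index
    set fixed, multiplies the \<open>v\<close>-determinant by the sign of \<open>p\<close> and moves
    \<open>p\<close> into the coordinates of the \<open>u\<close>-factor.\<close>
  have permuted: "?D = (\<Sum>f\<in>?\<F>. of_int (sign p) * (\<Prod>i\<in>UNIV. u (f i) $ inv_into UNIV p i) * det (\<chi> i. v (f i)))"
    if p: "p \<in> ?P" for p
  proof -
    from p have pp: "p permutes UNIV" by simp
    have "bij_betw (\<lambda>f. f \<circ> p) ?\<F> ?\<F>"
      by (rule bij_betw_byWitness[where f' = "\<lambda>f. f \<circ> inv_into UNIV p"])
        (auto simp: fun_eq_iff permutes_inverses[OF pp])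
    then have "?D = (\<Sum>f\<in>?\<F>. (\<Prod>i\<in>UNIV. u ((f \<circ> p) i) $ i) * det (\<chi> i. v ((f \<circ> p) i)))"
      unfolding expand
      by (rule sum.reindex_bij_betw[symmetric, where g = "\<lambda>f. (\<Prod>i\<in>UNIV. u (f i) $ i) * det (\<chi> i. v (f i))"])
    moreover have "det (\<chi> i. v ((f \<circ> p) i)) = of_int (sign p) * det (\<chi> i. v (f i))" for f
      using det_permute_rows[OF pp, of "\<chi> i. v (f i)"] by simp
    moreover have "(\<Prod>i\<in>UNIV. u ((f \<circ> p) i) $ i) = (\<Prod>i\<in>UNIV. u (f i) $ inv_into UNIV p i)" for f
      using prod.permute[OF pp, of "\<lambda>i. u (f i) $ inv_into UNIV p i"]
      by (simp add: o_def permutes_inverses[OF pp])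
    ultimately show ?thesis
      by (simp add: mult_ac)
  qed
  have "fact CARD('n) * ?D = (\<Sum>p\<in>?P. ?D)"
    by (simp add: card_permutations)
  also have "\<dots> = (\<Sum>p\<in>?P. \<Sum>f\<in>?\<F>. of_int (sign p) * (\<Prod>i\<in>UNIV. u (f i) $ inv_into UNIV p i) *
      det (\<chi> i. v (f i)))"
    using permuted by (intro sum.cong) auto
  also have "\<dots> = (\<Sum>p\<in>?P. \<Sum>f\<in>?\<F>. of_int (sign p) * (\<Prod>i\<in>UNIV. u (f i) $ p i) * det (\<chi> i. v (f i)))"
    by (subst sum_permutations_inverse)
      (auto simp: sign_inverse permutes_inv_inv permutes_imp_permutation[OF finite] intro!: sum.cong)
  also have "\<dots> = (\<Sum>f\<in>?\<F>. det (\<chi> i. u (f i)) * det (\<chi> i. v (f i)))"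
    by (subst sum.swap) (simp add: det_def[of "\<chi> i. u (_ i)"] sum_distrib_right)
  finally show ?thesis .
qed

subsection \<open>Path components of the general linear group\<close>

lemma continuous_on_det [continuous_intros]:
  fixes f :: "'a::topological_space \<Rightarrow> real ^ 'n::finite ^ 'n"
  assumes "continuous_on S f"
  shows "continuous_on S (\<lambda>x. det (f x))"
  unfolding det_def by (intro continuous_intros assms)

lemma continuous_on_matrix_mult [continuous_intros]:
  fixes f :: "'a::topological_space \<Rightarrow> real ^ 'n::finite ^ 'm::finite" and g :: "'a \<Rightarrow> real ^ 'k::finite ^ 'n"
  assumes "continuous_on S f" "continuous_on S g"
  shows "continuous_on S (\<lambda>x. f x ** g x)"
  unfolding matrix_matrix_mult_def by (intro continuous_intros assms)

text \<open>The Householder reflection in the hyperplane orthogonal to \<open>v\<close>. Dividing by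
  \<open>v \<bullet> v\<close> instead of requiring a unit vector makes it a continuous function on
  all nonzero vectors.\<close>

definition reflection :: "real ^ 'n::finite \<Rightarrow> real ^ 'n ^ 'n" where
  "reflection v = (\<chi> i j. (if i = j then 1 else 0) - 2 * (v $ i * v $ j) / (v \<bullet> v))"

lemma reflection_vector_mult:
  "reflection v *v x = x - (2 * (v \<bullet> x) / (v \<bullet> v)) *\<^sub>R v"
proof (simp add: vec_eq_iff reflection_def matrix_vector_mult_def, intro allI)
  fix i
  have "(\<Sum>j\<in>UNIV. ((if i = j then 1 else 0) - 2 * (v $ i * v $ j) / (v \<bullet> v)) * x $ j) =
    (\<Sum>j\<in>UNIV. (if i = j then x $ j else 0) - (2 * v $ i / (v \<bullet> v)) * (v $ j * x $ j))"
    by (intro sum.cong) (auto simp: field_simps)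
  also have "\<dots> = x $ i - (2 * v $ i / (v \<bullet> v)) * (v \<bullet> x)"
    by (simp add: sum_subtractf inner_vec_def sum_distrib_left)
  finally show "(\<Sum>j\<in>UNIV. ((if i = j then 1 else 0) - 2 * (v $ i * v $ j) / (v \<bullet> v)) * x $ j) =
      x $ i - 2 * (v \<bullet> x) * v $ i / (v \<bullet> v)"
    by (simp add: mult_ac)
qed

lemma reflection_involutive:
  assumes "v \<noteq> 0"
  shows "reflection v ** reflection v = mat 1"
proof -
  have "reflection v *v (reflection v *v x) = x" for x
    using assms by (simp add: reflection_vector_mult inner_diff_right divide_simps flip: scaleR_diff_left scaleR_add_left)
  then show ?thesis
    by (simp add: matrix_eq flip: matrix_vector_mul_assoc)
qed

lemma det_reflection_nonzero:
  assumes "v \<noteq> 0"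
  shows "det (reflection v) \<noteq> 0"
  using arg_cong[OF reflection_involutive[OF assms], of det] by (auto simp: det_mul)

lemma continuous_on_reflection: "continuous_on (- {0}) reflection"
  unfolding reflection_def by (intro continuous_intros) auto

lemma reflection_axis:
  "reflection (axis k 1) = (\<chi> i j. if i = j then if i = k then - 1 else 1 else 0)"
proof -
  have "axis k 1 \<bullet> axis k (1 :: real) = 1"
    by (simp add: inner_axis_axis)
  then show ?thesis
    by (auto simp: reflection_def vec_eq_iff axis_def)
qed

text \<open>Reflecting in the hyperplane where coordinates \<open>m\<close> and \<open>n\<close>
  agree swaps them. The right-hand side has the shape in which
  \<open>induct_matrix_elementary_alt\<close> presents swaps.\<close>

lemma reflection_axis_diff:
  assumes "m \<noteq> n"
  shows "reflection (axis m 1 - axis n 1) = (\<chi> i j. mat 1 $ i $ Transposition.transpose m n j)"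
proof -
  have "(axis m 1 - axis n 1) \<bullet> (axis m 1 - axis n (1 :: real)) = 2"
    using assms by (simp add: inner_diff_left inner_diff_right inner_axis_axis)
  with assms show ?thesis
    by (auto simp: reflection_def vec_eq_iff axis_def mat_def Transposition.transpose_def)
qed

lemma diagonal_matrix_mult:
  fixes a b :: "'n::finite \<Rightarrow> real"
  shows "(\<chi> i j. if i = j then a i else 0) ** (\<chi> i j. if i = j then b i else 0) =
    (\<chi> i j. if i = j then a i * b i else 0)"
proof -
  have "(\<Sum>k\<in>UNIV. (if i = k then a i else 0) * (if k = j then b k else 0)) = (if i = j then a i * b i else 0)" for i j
    by (simp add: if_distrib[of "\<lambda>x. x * _"] cong: if_cong)
  then show ?thesis
    by (simp add: matrix_matrix_mult_def vec_eq_iff)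
qed

abbreviation GL :: "(real ^ 'n::finite ^ 'n) set" where
  "GL \<equiv> {M. det M \<noteq> 0}"

text \<open>A path of nonzero vectors from \<open>v\<close> to \<open>w\<close> yields a path of
  reflections. Such a path exists when the dimension is at least 2; in dimension 1 the punctured
  line is disconnected, but every reflection is \<open>- mat 1\<close>.\<close>

lemma path_component_GL_reflection:
  assumes "v \<noteq> 0" "w \<noteq> 0"
  shows "path_component GL (reflection (v :: real ^ 'n::finite)) (reflection w)"
proof (cases "CARD('n) = 1")
  case True
  then obtain k :: 'n where k: "UNIV = {k}"
    by (rule card_1_singletonE)
  have "reflection x = - mat 1" if "x \<noteq> 0" for x :: "real ^ 'n"
  proof -
    have "x $ k \<noteq> 0"
      using that k by (metis vec_eq_iff zero_index singletonD UNIV_I)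
    then have "reflection x $ k $ k = (- mat 1 :: real ^ 'n ^ 'n) $ k $ k"
      by (simp add: reflection_def mat_def inner_vec_def k)
    moreover have "i = k" for i
      using k by (metis UNIV_I singletonD)
    ultimately show ?thesis
      by (metis vec_eq_iff)
  qed
  then show ?thesis
    using assms by (metis (mono_tags) det_reflection_nonzero mem_Collect_eq path_component_refl)
next
  case False
  moreover have "CARD('n) > 0" by simp
  ultimately have "2 \<le> CARD('n)" by linarith
  then have "path_connected (reflection ` (- {0 :: real ^ 'n}))"
    by (intro path_connected_continuous_image path_connected_punctured_universe continuous_on_reflection) simp
  then have "path_component (reflection ` (- {0})) (reflection v) (reflection w)"
    using assms unfolding path_connected_component by blast
  then show ?thesis
    by (rule path_component_of_subset[rotated]) (auto dest: det_reflection_nonzero)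
qed

lemma path_component_GL_mult:
  assumes "path_component GL A A'" "path_component GL B B'"
  shows "path_component GL (A ** B) (A' ** B')"
proof -
  obtain g h where g: "path g" "path_image g \<subseteq> GL" "pathstart g = A" "pathfinish g = A'"
    and h: "path h" "path_image h \<subseteq> GL" "pathstart h = B" "pathfinish h = B'"
    using assms unfolding path_component_def by blast
  have "path (\<lambda>t. g t ** h t)"
    using g(1) h(1) unfolding path_def by (intro continuous_intros)
  moreover have "path_image (\<lambda>t. g t ** h t) \<subseteq> GL"
    using g(2) h(2) unfolding path_image_def image_subset_iff by (simp add: det_mul)
  ultimately show ?thesis
    using g h unfolding path_component_def
    by (intro exI[of _ "\<lambda>t. g t ** h t"]) (auto simp: pathstart_def pathfinish_def)
qed

lemma path_component_GL_segment:
  assumes "\<And>t. 0 \<le> t \<Longrightarrow> t \<le> 1 \<Longrightarrow> det ((1 - t) *\<^sub>R A + t *\<^sub>R B) \<noteq> 0"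
  shows "path_component GL A B"
  unfolding path_component_def
proof (intro exI conjI)
  show "path_image (linepath A B) \<subseteq> GL"
    using assms by (auto simp: path_image_def linepath_def)
qed auto

text \<open>The matrices joined to \<open>mat 1\<close> or to one fixed reflection are closed under
  products, because the reflection squares to \<open>mat 1\<close>. It therefore suffices to treat
  the elementary factors: diagonal matrices, swaps and shears.\<close>

lemma path_component_GL:
  fixes A :: "real ^ 'n::finite ^ 'n"
  assumes "det A \<noteq> 0"
  shows "path_component GL (mat 1) A \<or> path_component GL (reflection (axis k 1)) A"
proof -
  let ?R = "reflection (axis k 1) :: real ^ 'n ^ 'n"
  let ?Q = "\<lambda>A. path_component GL (mat 1) A \<or> path_component GL ?R A"
  have one: "?Q (mat 1)"
    by (simp add: path_component_refl)
  have mult: "?Q (A ** B)" if "?Q A" "?Q B" for A B :: "real ^ 'n ^ 'n"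
  proof -
    have "?R ** ?R = mat 1"
      by (simp add: reflection_involutive axis_eq_0_iff)
    then show ?thesis
      using that path_component_GL_mult[of "mat 1" A "mat 1" B] path_component_GL_mult[of "mat 1" A ?R B]
        path_component_GL_mult[of ?R A "mat 1" B] path_component_GL_mult[of ?R A ?R B]
      by (auto simp only: matrix_mul_lid matrix_mul_rid)
  qed
  have refl: "?Q (reflection v)" if "v \<noteq> 0" for v
    using path_component_GL_reflection[of "axis k 1" v] that by (simp add: axis_eq_0_iff)
  \<comment> \<open>A diagonal matrix of signs is a product of axis reflections, one for each
    \<open>l \<in> J\<close>.\<close>
  have signs: "?Q (\<chi> i j. if i = j then if i \<in> J then - 1 else 1 else 0)" if "finite J" for J
    using that
  proof (induction J)
    case empty
    have "(\<chi> i j. if i = j then if i \<in> {} then - 1 else 1 else 0) = (mat 1 :: real ^ 'n ^ 'n)"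
      by (auto simp: mat_def vec_eq_iff)
    with one show ?case by metis
  next
    case (insert l J)
    have "(\<chi> i j. if i = j then if i \<in> insert l J then - 1 else 1 else 0) =
      reflection (axis l 1) ** (\<chi> i j. if i = j then if i \<in> J then - 1 else 1 else 0)"
      using insert(2) by (auto simp: reflection_axis diagonal_matrix_mult vec_eq_iff)
    then show ?case
      using mult[OF refl[of "axis l 1"] insert.IH] by (simp add: axis_eq_0_iff)
  qed
  have "det A \<noteq> 0 \<longrightarrow> ?Q A"
  proof (induction A rule: induct_matrix_elementary_alt)
    case (1 A B)
    then show ?case using mult by (auto simp: det_mul)
  next
    case (2 A i)
    then show ?case by (simp add: det_zero_row)
  next
    case (3 A)
    show ?case
    proof
      assume A: "det A \<noteq> 0"
      then have nz: "A $ i $ i \<noteq> 0" for i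
        using 3 by (auto simp: det_diagonal)
      define J where "J = {i. A $ i $ i < 0}"
      let ?S = "(\<chi> i j. if i = j then if i \<in> J then - 1 else 1 else 0) :: real ^ 'n ^ 'n"
      \<comment> \<open>Moving in a straight line from its sign to its value, no diagonal entry
        passes through zero.\<close>
      have "det ((1 - t) *\<^sub>R ?S + t *\<^sub>R A) \<noteq> 0" if "0 \<le> t" "t \<le> 1" for t
      proof -
        have pos: "1 - t + t * x > 0" if "x > 0" for x :: real
        proof (cases "t = 0")
          case False
          then show ?thesis
            using \<open>x > 0\<close> \<open>0 \<le> t\<close> \<open>t \<le> 1\<close> by (intro add_nonneg_pos mult_pos_pos) auto
        qed simp
        have "(1 - t) * (if i \<in> J then - 1 else 1) + t * A $ i $ i \<noteq> 0" for i
          using nz[of i] pos[of "A $ i $ i"] pos[of "- A $ i $ i"] by (auto simp: J_def)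
        then show ?thesis
          using 3 by (simp add: det_diagonal)
      qed
      then have "path_component GL ?S A"
        by (rule path_component_GL_segment)
      with signs[OF finite, of J] show "?Q A"
        by (meson path_component_trans)
    qed
  next
    case (4 m n)
    then show ?case
      using refl[of "axis m 1 - axis n 1"] reflection_axis_diff[of m n] by (simp add: axis_eq_axis)
  next
    case (5 m n)
    let ?E = "(\<chi> i j. of_bool (i = m \<and> j = n \<or> i = j)) :: real ^ 'n ^ 'n"
    have "path_component GL (mat 1) ?E"
    proof (rule path_component_GL_segment)
      fix t :: real
      \<comment> \<open>Every point of the segment is again a shear, obtained from
        \<open>mat 1\<close> by a row operation, so its determinant stays 1.\<close>
      have "(1 - t) *\<^sub>R mat 1 + t *\<^sub>R ?E = (\<chi> k. if k = m then row m (mat 1) + t *s row n (mat 1) else row k (mat 1))"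
        using 5 by (auto simp: vec_eq_iff mat_def row_def)
      then show "det ((1 - t) *\<^sub>R mat 1 + t *\<^sub>R ?E) \<noteq> 0"
        using det_row_operation[OF 5, of "mat 1" t] by simp
    qed
    then show ?case by simp
  qed
  then show ?thesis using assms by simp
qed

text \<open>The determinant would vanish somewhere on a path from \<open>mat 1\<close> to
  \<open>A\<close>, which leaves only the other alternative of
  \<open>path_component_GL\<close>.\<close>

lemma path_component_GL_det_neg:
  fixes A :: "real ^ 'n::finite ^ 'n"
  assumes "det A < 0"
  shows "path_component GL (reflection (axis k 1)) A"
proof -
  have False if conn: "path_component GL (mat 1) A"
  proof -
    obtain g where g: "path g" "path_image g \<subseteq> GL" "pathstart g = mat 1" "pathfinish g = A"
      using conn unfolding path_component_def by blast
    have "continuous_on {0..1} (\<lambda>t. det (g t))"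
      using g(1) unfolding path_def by (intro continuous_intros)
    moreover have "det (g 1) \<le> 0" "0 \<le> det (g 0)"
      using g assms by (auto simp: pathstart_def pathfinish_def)
    ultimately obtain t where "0 \<le> t" "t \<le> 1" "det (g t) = 0"
      using IVT2'[of "\<lambda>t. det (g t)" 1 0 0] by auto
    then show False
      using g(2) unfolding path_image_def image_subset_iff by simp
  qed
  then show ?thesis
    using path_component_GL[of A k] assms by auto
qed

subsection \<open>Linear maps of negative determinant and the degree\<close>

lemma continuous_on_matrix_vector_mult [continuous_intros]:
  fixes f :: "'a::topological_space \<Rightarrow> real ^ 'n::finite ^ 'm::finite" and g :: "'a \<Rightarrow> real ^ 'n"
  assumes "continuous_on S f" "continuous_on S g"
  shows "continuous_on S (\<lambda>x. f x *v g x)"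
  unfolding matrix_vector_mult_def by (intro continuous_intros assms)

lemma matrix_vector_mult_nonzero:
  fixes A :: "real ^ 'n::finite ^ 'n"
  assumes "det A \<noteq> 0" "x \<noteq> 0"
  shows "A *v x \<noteq> 0"
proof -
  have "\<exists>B. B ** A = mat 1"
    using assms(1) by (simp add: invertible_left_inverse flip: invertible_det_nz)
  with assms(2) show ?thesis
    unfolding matrix_left_invertible_ker by blast
qed

lemma homotopic_GL:
  fixes A B :: "real ^ 'n::finite ^ 'n"
  assumes "path_component GL A B"
  shows "homotopic_with_canon (\<lambda>_. True) (sphere 0 1) (- {0}) ((*v) A) ((*v) B)"
proof -
  obtain g where g: "path g" "path_image g \<subseteq> GL" "g 0 = A" "g 1 = B"
    using assms unfolding path_component_def pathstart_def pathfinish_def by blast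
  have "continuous_on ({0..1} \<times> sphere 0 1) (\<lambda>z. g (fst z))"
    using g(1) unfolding path_def
    by (rule continuous_on_compose2) (auto intro!: continuous_intros)
  then have "continuous_on ({0..1} \<times> sphere 0 1) (\<lambda>z. g (fst z) *v snd z)"
    by (intro continuous_intros)
  moreover have "g t *v x \<noteq> 0" if "t \<in> {0..1}" "x \<in> sphere 0 1" for t x
    using g(2) that unfolding path_image_def image_subset_iff
    by (intro matrix_vector_mult_nonzero) auto
  ultimately have "continuous_map (prod_topology (top_of_set {0..1}) (top_of_set (sphere 0 1))) (top_of_set (- {0}))
      (\<lambda>z. g (fst z) *v snd z)"
    by (simp add: Pi_iff mem_Times_iff)
  then show ?thesis
    using g(3,4) unfolding homotopic_with_def
    by (intro exI[of _ "\<lambda>z. g (fst z) *v snd z"] conjI) simp_all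
qed

text \<open>The two maps have Brouwer degrees 1 and -1. The degree is defined for self-maps of
  \<open>nsphere p\<close>, a set of sequences, so both maps are transported there. A single axis
  \<open>k\<close> suffices, since \<open>path_component_GL_det_neg\<close> holds for every
  axis.\<close>

lemma reflection_not_homotopic_id:
  obtains k where "\<not> homotopic_with_canon (\<lambda>_. True) (sphere 0 1) (- {0}) id ((*v) (reflection (axis (k :: 'n::finite) 1)))"
proof -
  \<comment> \<open>The sphere of a space of dimension \<open>p + 1\<close> has dimension
    \<open>p\<close>; its coordinates are numbered from 0 to \<open>p\<close>.\<close>
  define p where "p = CARD('n) - 1"
  have "CARD('n) = Suc p"
    unfolding p_def by simp
  then obtain e where "bij_betw e {0..<Suc p} (UNIV :: 'n set)"
    by (metis ex_bij_betw_nat_finite finite)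
  then have e: "bij_betw e {..p} (UNIV :: 'n set)"
    by (simp add: atLeast0LessThan lessThan_Suc_atMost)
  define e' where "e' = inv_into {..p} e"
  have e': "e' i \<le> p" "e (e' i) = i" for i
    using e bij_betw_inv_into_right[OF e] bij_betw_inv_into[OF e] unfolding e'_def
    by (auto simp: bij_betw_def)
  have e'e: "e' (e j) = j" if "j \<le> p" for j
    using that bij_betw_inv_into_left[OF e] unfolding e'_def by simp
  \<comment> \<open>Renaming coordinates along \<open>e\<close> identifies the two unit spheres;
    points of \<open>nsphere p\<close> vanish beyond index \<open>p\<close>.\<close>
  define \<phi> :: "real ^ 'n \<Rightarrow> nat \<Rightarrow> real" where "\<phi> y = (\<lambda>j. if j \<le> p then y $ e j else 0)" for y
  define \<psi> :: "(nat \<Rightarrow> real) \<Rightarrow> real ^ 'n" where "\<psi> x = (\<chi> i. x (e' i))" for x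
  let ?S = "sphere (0 :: real ^ 'n) 1" and ?R = "reflection (axis (e 0) 1) :: real ^ 'n ^ 'n"
  have norm1: "norm y = 1 \<longleftrightarrow> (\<Sum>i\<in>UNIV. (y $ i)\<^sup>2) = 1" for y :: "real ^ 'n"
    by (simp add: norm_vec_def L2_set_def)
  have sum_e: "(\<Sum>j\<le>p. f (e j)) = (\<Sum>i\<in>UNIV. f i)" for f :: "'n \<Rightarrow> real"
    by (rule sum.reindex_bij_betw[OF e])
  have \<phi>: "continuous_map (top_of_set ?S) (nsphere p) \<phi>"
    unfolding nsphere continuous_map_in_subtopology
  proof
    show "continuous_map (top_of_set ?S) (powertop_real UNIV) \<phi>"
      unfolding continuous_map_componentwise_UNIV \<phi>_def
      by (auto intro!: continuous_intros)
    show "\<phi> \<in> topspace (top_of_set ?S) \<rightarrow> {x. (\<Sum>i\<le>p. (x i)\<^sup>2) = 1 \<and> (\<forall>i>p. x i = 0)}"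
      using sum_e[of "\<lambda>i. (_ $ i)\<^sup>2"] by (auto simp: \<phi>_def norm1)
  qed
  have \<psi>_sphere: "\<psi> x \<in> ?S" and \<psi>_inverse: "\<phi> (\<psi> x) = x" if "x \<in> topspace (nsphere p)" for x
  proof -
    from that have x: "(\<Sum>i\<le>p. (x i)\<^sup>2) = 1" "\<And>i. i > p \<Longrightarrow> x i = 0"
      by (auto simp: nsphere)
    have "(\<Sum>i\<in>UNIV. (\<psi> x $ i)\<^sup>2) = (\<Sum>j\<le>p. (x j)\<^sup>2)"
      unfolding sum_e[symmetric] by (intro sum.cong) (auto simp: \<psi>_def e'e)
    with x show "\<psi> x \<in> ?S"
      by (simp add: norm1)
    show "\<phi> (\<psi> x) = x"
      using x by (auto simp: \<phi>_def \<psi>_def e'e fun_eq_iff not_le)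
  qed
  have \<psi>: "continuous_map (nsphere p) (top_of_set ?S) \<psi>"
    unfolding continuous_map_in_subtopology
  proof
    have "limitin euclideanreal (\<lambda>x. x k) (y k) (atin (nsphere p) y)" if "y \<in> topspace (nsphere p)" for y k
      using that continuous_map_nsphere_projection[of p k] unfolding continuous_map_atin by blast
    then show "continuous_map (nsphere p) euclidean \<psi>"
      unfolding continuous_map_atin \<psi>_def by (auto intro!: tendsto_vec_lambda)
    show "\<psi> \<in> topspace (nsphere p) \<rightarrow> ?S"
      using \<psi>_sphere by blast
  qed
  have R_component: "(?R *v y) $ i = (if i = e 0 then - y $ i else y $ i)" for y i
  proof -
    have "?R *v y = y - (2 * y $ e 0) *\<^sub>R axis (e 0) 1"
      by (simp add: reflection_vector_mult inner_axis_axis inner_axis')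
    then show ?thesis
      by (simp add: axis_def)
  qed
  have False if "homotopic_with_canon (\<lambda>_. True) ?S (- {0}) id ((*v) ?R)"
  proof -
    \<comment> \<open>Normalization brings the homotopy, which runs in the punctured space, back
      into the sphere.\<close>
    have "continuous_map (top_of_set (- {0})) (top_of_set ?S) (\<lambda>y. y /\<^sub>R norm y)"
      by (auto intro!: continuous_intros)
    from homotopic_with_compose_continuous_map_left[OF that this, of "\<lambda>_. True"]
    have "homotopic_with_canon (\<lambda>_. True) ?S ?S ((\<lambda>y. y /\<^sub>R norm y) \<circ> id) ((\<lambda>y. y /\<^sub>R norm y) \<circ> (*v) ?R)"
      by simp
    from homotopic_with_compose_continuous_map_left[OF this \<phi>, of "\<lambda>_. True"]
    have "homotopic_with (\<lambda>_. True) (top_of_set ?S) (nsphere p)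
       (\<phi> \<circ> ((\<lambda>y. y /\<^sub>R norm y) \<circ> id)) (\<phi> \<circ> ((\<lambda>y. y /\<^sub>R norm y) \<circ> (*v) ?R))"
      by simp
    from homotopic_with_compose_continuous_map_right[OF this \<psi>, of "\<lambda>_. True"]
    have "Brouwer_degree2 p (\<phi> \<circ> ((\<lambda>y. y /\<^sub>R norm y) \<circ> id) \<circ> \<psi>) =
        Brouwer_degree2 p (\<phi> \<circ> ((\<lambda>y. y /\<^sub>R norm y) \<circ> (*v) ?R) \<circ> \<psi>)"
      by (intro Brouwer_degree2_homotopic) simp
    moreover have "Brouwer_degree2 p (\<phi> \<circ> ((\<lambda>y. y /\<^sub>R norm y) \<circ> id) \<circ> \<psi>) = Brouwer_degree2 p id"
      using \<psi>_sphere \<psi>_inverse by (intro Brouwer_degree2_eq) auto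
    \<comment> \<open>The axis is \<open>e 0\<close> because the reflection of known degree negates
      coordinate 0. Agreement on the sphere is enough for equal degrees.\<close>
    moreover have "Brouwer_degree2 p (\<phi> \<circ> ((\<lambda>y. y /\<^sub>R norm y) \<circ> (*v) ?R) \<circ> \<psi>) =
        Brouwer_degree2 p (\<lambda>x i. if i = 0 then - x i else x i)"
    proof (intro Brouwer_degree2_eq)
      fix x assume x: "x \<in> topspace (nsphere p)"
      have "norm (?R *v \<psi> x) = 1"
      proof -
        have "((?R *v \<psi> x) $ i)\<^sup>2 = (\<psi> x $ i)\<^sup>2" for i
          by (simp add: R_component)
        then show ?thesis
          using \<psi>_sphere[OF x] by (simp add: norm1)
      qed
      then have "(\<phi> \<circ> ((\<lambda>y. y /\<^sub>R norm y) \<circ> (*v) ?R) \<circ> \<psi>) x = \<phi> (?R *v \<psi> x)"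
        by simp
      also have "\<dots> = (\<lambda>i. if i = 0 then - \<phi> (\<psi> x) i else \<phi> (\<psi> x) i)"
      proof
        fix i
        show "\<phi> (?R *v \<psi> x) i = (if i = 0 then - \<phi> (\<psi> x) i else \<phi> (\<psi> x) i)"
          using e'e[of i] e'e[of 0] by (auto simp: \<phi>_def R_component)
      qed
      finally show "(\<phi> \<circ> ((\<lambda>y. y /\<^sub>R norm y) \<circ> (*v) ?R) \<circ> \<psi>) x = (\<lambda>i. if i = 0 then - x i else x i)"
        unfolding \<psi>_inverse[OF x] .
    qed
    ultimately show False
      by (simp add: Brouwer_degree2_reflection)
  qed
  with that show thesis by blast
qed

lemma det_neg_not_homotopic_id:
  fixes A :: "real ^ 'n::finite ^ 'n"
  assumes "det A < 0"
  shows "\<not> homotopic_with_canon (\<lambda>_. True) (sphere 0 1) (- {0}) id ((*v) A)"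
proof
  assume A: "homotopic_with_canon (\<lambda>_. True) (sphere 0 1) (- {0}) id ((*v) A)"
  obtain k :: 'n where k: "\<not> homotopic_with_canon (\<lambda>_. True) (sphere 0 1) (- {0}) id ((*v) (reflection (axis k 1)))"
    using reflection_not_homotopic_id by blast
  have "homotopic_with_canon (\<lambda>_. True) (sphere 0 1) (- {0}) ((*v) A) ((*v) (reflection (axis k 1)))"
    by (rule homotopic_GL[OF path_component_sym[OF path_component_GL_det_neg[OF assms]]])
  with A k show False
    by (blast intro: homotopic_with_trans)
qed

section \<open>The finite case, by a degree argument\<close>

text \<open>If every unit vector failed, the positive parts of the products would serve as weights
  of a map linking the identity to a linear map of negative determinant. The tuple \<open>f0\<close>
  makes that determinant strictly negative.\<close>

lemma exists_common_nonpos_direction: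
  fixes u v :: "'a \<Rightarrow> real ^ 'n::finite"
  assumes F: "finite F"
    and nonpos: "\<And>f :: 'n \<Rightarrow> 'a. (\<And>i. f i \<in> F) \<Longrightarrow> det (\<chi> i. u (f i)) * det (\<chi> i. v (f i)) \<le> 0"
    and neg: "\<And>i. f0 i \<in> F" "det (\<chi> i. u (f0 i)) * det (\<chi> i. v (f0 i)) < 0"
  obtains x where "norm x = 1" "\<And>a. a \<in> F \<Longrightarrow> (u a \<bullet> x) * (v a \<bullet> x) \<le> 0"
proof -
  define M where "M d = (\<chi> i j. \<Sum>a\<in>F. d a * u a $ i * v a $ j)" for d :: "'a \<Rightarrow> real"
  have M_mult: "M d *v x = (\<Sum>a\<in>F. (d a * (v a \<bullet> x)) *\<^sub>R u a)" for d x
  proof -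
    have "(\<Sum>j\<in>UNIV. (\<Sum>a\<in>F. d a * u a $ i * v a $ j) * x $ j) = (\<Sum>a\<in>F. d a * (v a \<bullet> x) * u a $ i)" for i
      unfolding sum_distrib_right
      by (subst sum.swap) (simp add: inner_vec_def sum_distrib_left sum_distrib_right mult_ac)
    then show ?thesis
      by (simp add: M_def matrix_vector_mult_def vec_eq_iff)
  qed
  have det_M: "det (M d) < 0" if d: "\<And>a. a \<in> F \<Longrightarrow> d a > 0" for d
  proof -
    have D: "det (\<chi> i. d (f i) *s u (f i)) * det (\<chi> i. v (f i)) =
        (\<Prod>i\<in>UNIV. d (f i)) * (det (\<chi> i. u (f i)) * det (\<chi> i. v (f i)))" for f :: "'n \<Rightarrow> 'a"
      by (simp add: det_rows_mul)
    have pos: "(\<Prod>i\<in>UNIV. d (f i)) > 0" if "\<And>i. f i \<in> F" for f :: "'n \<Rightarrow> 'a"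
      using that d by (intro prod_pos) auto
    have fin: "finite {f :: 'n \<Rightarrow> 'a. \<forall>i. f i \<in> F}"
      using finite_PiE[of "UNIV :: 'n set" "\<lambda>_. F"] F by (simp add: PiE_UNIV_domain Pi_def)
    \<comment> \<open>The weights are absorbed into \<open>u\<close> for Cauchy-Binet and then
      pulled out of the rows as a positive product. No summand is positive, and the one for
      \<open>f0\<close> is negative.\<close>
    have "fact CARD('n) * det (M d) =
      (\<Sum>f | \<forall>i. f i \<in> F. det (\<chi> i. d (f i) *s u (f i)) * det (\<chi> i. v (f i)))"
      using cauchy_binet_sum[OF F, where u = "\<lambda>a. d a *s u a" and v = v] by (simp add: M_def)
    also have "\<dots> < (\<Sum>f | \<forall>i. (f :: 'n \<Rightarrow> 'a) i \<in> F. 0)"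
      unfolding D
    proof (rule sum_strict_mono_ex1[OF fin])
      show "\<forall>f\<in>{f. \<forall>i. f i \<in> F}. (\<Prod>i\<in>UNIV. d (f i)) * (det (\<chi> i. u (f i)) * det (\<chi> i. v (f i))) \<le> 0"
      proof
        fix f :: "'n \<Rightarrow> 'a" assume "f \<in> {f. \<forall>i. f i \<in> F}"
        then show "(\<Prod>i\<in>UNIV. d (f i)) * (det (\<chi> i. u (f i)) * det (\<chi> i. v (f i))) \<le> 0"
          using pos[of f] nonpos[of f] by (intro mult_nonneg_nonpos[of "\<Prod>i\<in>UNIV. d (f i)"]) auto
      qed
      show "\<exists>f\<in>{f. \<forall>i. f i \<in> F}. (\<Prod>i\<in>UNIV. d (f i)) * (det (\<chi> i. u (f i)) * det (\<chi> i. v (f i))) < 0"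
        using pos[of f0] neg by (intro bexI[of _ f0] mult_pos_neg[of "\<Prod>i\<in>UNIV. d (f0 i)"]) auto
    qed
    finally show ?thesis
      by (simp add: mult_less_0_iff)
  qed
  have False if *: "\<And>x. norm x = 1 \<Longrightarrow> \<exists>a\<in>F. (u a \<bullet> x) * (v a \<bullet> x) > 0"
  proof -
    define q where "q a x = max 0 ((u a \<bullet> x) * (v a \<bullet> x))" for a x
    define G where "G x = M (\<lambda>a. q a x) *v x" for x
    have G_pos: "x \<bullet> G x > 0" if "norm x = 1" for x
    proof -
      obtain b where b: "b \<in> F" "(u b \<bullet> x) * (v b \<bullet> x) > 0"
        using * \<open>norm x = 1\<close> by blast
      \<comment> \<open>By the choice of \<open>q\<close>, each summand is the square of the
        positive part of \<open>(u a \<bullet> x) * (v a \<bullet> x)\<close>.\<close>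
      have "x \<bullet> G x = (\<Sum>a\<in>F. q a x * ((u a \<bullet> x) * (v a \<bullet> x)))"
        by (simp add: G_def M_mult inner_sum_right inner_commute mult_ac)
      also have "\<dots> > 0"
        using b by (intro sum_pos2[OF F b(1)]) (auto simp: q_def max_def mult_nonneg_nonneg)
      finally show ?thesis .
    qed
    have cont: "continuous_on (sphere 0 1) G"
      unfolding G_def M_mult q_def by (intro continuous_intros)
    have "homotopic_with_canon (\<lambda>_. True) (sphere 0 1) (- {0}) id G"
    proof (rule homotopic_with_linear)
      fix x :: "real ^ 'n" assume "x \<in> sphere 0 1"
      then have x: "norm x = 1" by simp
      \<comment> \<open>The whole segment from \<open>x\<close> to \<open>G x\<close> lies in the
        open half-space of vectors with positive inner product with \<open>x\<close>.\<close>
      have "x \<bullet> ((1 - s) *\<^sub>R x + s *\<^sub>R G x) > 0" if "0 \<le> s" "s \<le> 1" for s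
      proof (cases "s = 0")
        case False
        then have "s * (x \<bullet> G x) > 0"
          using that G_pos[OF x] by simp
        then show ?thesis
          using that x by (simp add: inner_add_right dot_square_norm add_nonneg_pos)
      qed (use x in \<open>simp add: dot_square_norm\<close>)
      then show "closed_segment (id x) (G x) \<subseteq> - {0}"
        by (force simp: closed_segment_def)
    qed (use cont in auto)
    moreover have "homotopic_with_canon (\<lambda>_. True) (sphere 0 1) (- {0}) G ((*v) (M (\<lambda>_. 1)))"
    proof (rule homotopic_with_linear)
      fix x :: "real ^ 'n" assume "x \<in> sphere 0 1"
      then have x: "norm x = 1" by simp
      have "(1 - s) *\<^sub>R G x + s *\<^sub>R (M (\<lambda>_. 1) *v x) \<noteq> 0" if "0 \<le> s" "s \<le> 1" for s
      proof (cases "s = 0")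
        case True
        then show ?thesis using G_pos[OF x] by auto
      next
        case False
        \<comment> \<open>\<open>M\<close> is linear in its weights, and for \<open>s > 0\<close>
          the combined weights are all positive. At \<open>s = 0\<close> some may vanish, so that
          endpoint is covered by \<open>G_pos\<close>.\<close>
        have "(1 - s) *\<^sub>R G x + s *\<^sub>R (M (\<lambda>_. 1) *v x) = M (\<lambda>a. (1 - s) * q a x + s) *v x"
          by (simp add: G_def M_mult scaleR_sum_right algebra_simps flip: sum.distrib)
        moreover have "det (M (\<lambda>a. (1 - s) * q a x + s)) < 0"
          using that False by (intro det_M add_nonneg_pos) (auto simp: q_def)
        ultimately show ?thesis
          using x matrix_vector_mult_nonzero[of "M (\<lambda>a. (1 - s) * q a x + s)" x] by force
      qed
      then show "closed_segment (G x) (M (\<lambda>_. 1) *v x) \<subseteq> - {0}"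
        by (force simp: closed_segment_def)
    qed (use cont in \<open>auto intro!: continuous_intros\<close>)
    ultimately have "homotopic_with_canon (\<lambda>_. True) (sphere 0 1) (- {0}) id ((*v) (M (\<lambda>_. 1)))"
      by (rule homotopic_with_trans)
    then show False
      using det_neg_not_homotopic_id det_M[of "\<lambda>_. 1"] by auto
  qed
  with that show thesis
    by (meson not_less)
qed

subsection \<open>Homogeneous coordinates and transversal hyperplanes\<close>

definition homog :: "real ^ 'd::finite \<Rightarrow> real ^ 'd option" where
  "homog a = (\<chi> i. case i of None \<Rightarrow> 1 | Some k \<Rightarrow> a $ k)"

lemma det_homog_matrix: "det (homog_matrix a) = det (\<chi> j. homog (a j))"
proof -
  have "homog_matrix a = transpose (\<chi> j. homog (a j))"
    by (simp add: homog_matrix_def homog_def transpose_def)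
  then show ?thesis by simp
qed

text \<open>A linear functional on homogeneous coordinates is an affine function of the point; this
  is how the vector \<open>x\<close> later becomes a hyperplane.\<close>

lemma inner_homog: "homog a \<bullet> x = (\<chi> i. x $ Some i) \<bullet> a + x $ None"
proof -
  have "(\<Sum>i\<in>UNIV. f i) = f None + (\<Sum>k\<in>UNIV. f (Some k))" for f :: "'a option \<Rightarrow> real"
    unfolding UNIV_option_conv by (subst sum.insert) (auto simp: sum.reindex)
  then show ?thesis
    by (simp add: inner_vec_def homog_def mult.commute)
qed

text \<open>The points whose lifts lie in the span form an affine set containing \<open>A\<close>,
  hence all points qualify. Lifts alone have last coordinate 1; multiples of \<open>homog 0\<close>
  correct it.\<close>

lemma span_homog:
  assumes "affine hull A = UNIV"
  shows "span (homog ` A) = UNIV"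
proof -
  have "affine {x. homog x \<in> span (homog ` A)}"
    unfolding affine_def
  proof (intro ballI allI impI)
    fix x y :: "real ^ 'a" and s t :: real
    assume "x \<in> {x. homog x \<in> span (homog ` A)}" "y \<in> {x. homog x \<in> span (homog ` A)}" and st: "s + t = 1"
    moreover have "homog (s *\<^sub>R x + t *\<^sub>R y) = s *\<^sub>R homog x + t *\<^sub>R homog y"
      using st by (auto simp: vec_eq_iff homog_def split: option.split)
    ultimately show "s *\<^sub>R x + t *\<^sub>R y \<in> {x. homog x \<in> span (homog ` A)}"
      by (simp add: span_add span_scale)
  qed
  moreover have "A \<subseteq> {x. homog x \<in> span (homog ` A)}"
    by (auto intro: span_base)
  ultimately have all: "homog x \<in> span (homog ` A)" for x
    using hull_minimal[of A "{x. homog x \<in> span (homog ` A)}" affine] assms by auto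
  have "y \<in> span (homog ` A)" for y
  proof -
    have "y = homog (\<chi> i. y $ Some i) + (y $ None - 1) *\<^sub>R homog 0"
      by (auto simp: vec_eq_iff homog_def split: option.split)
    then show ?thesis
      using all by (metis span_add span_scale)
  qed
  then show ?thesis by blast
qed

text \<open>A basis chosen among the lifts of \<open>A\<close> has as many elements as there are
  indices, and its elements are the rows of an invertible matrix.\<close>

lemma det_homog_matrix_nonzero:
  fixes A :: "(real ^ 'd::finite) set"
  assumes "affine hull A = UNIV"
  obtains a where "\<And>j. a j \<in> A" "det (homog_matrix a) \<noteq> 0"
proof -
  obtain B where B: "B \<subseteq> homog ` A" "independent B" "homog ` A \<subseteq> span B" "card B = dim (homog ` A)"
    using basis_exists by blast
  have span: "span B = UNIV"
    using B(1,3) span_homog[OF assms] span_mono span_minimal subspace_span by (metis top.extremum_uniqueI)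
  have "card B = CARD('d option)"
    using B(4) span_homog[OF assms] by (metis dim_span dim_UNIV DIM_cart DIM_real mult.right_neutral)
  then obtain f where f: "bij_betw f (UNIV :: 'd option set) B"
    using finite_same_card_bij[of UNIV B] B(2) finiteI_independent by (metis finite)
  then have "f j \<in> homog ` A" for j
    using B(1) by (auto simp: bij_betw_def)
  then have "\<forall>j. \<exists>a\<in>A. homog a = f j"
    unfolding image_iff by metis
  then obtain a where a: "\<And>j. a j \<in> A" "\<And>j. homog (a j) = f j"
    by metis
  have "rows (\<chi> j. f j) = B"
    using f by (auto simp: rows_def row_def bij_betw_def)
  then have "invertible (\<chi> j. f j)"
    using span by (simp add: invertible_left_inverse matrix_left_invertible_span_rows span_vec_eq)
  then show thesis
    using that[of a] by (simp add: det_homog_matrix invertible_det_nz a)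
qed

section \<open>From finite families to the transversal hyperplane\<close>

theorem theorem2p1:
  fixes A B :: "(real ^ 'd::finite) set"
    and \<gamma> :: "real ^ 'd \<Rightarrow> real ^ 'd"
  assumes "affine hull A = UNIV"
    and "affine hull B = UNIV"
    and "order_type_reversing A B \<gamma>"
  shows "\<exists>H. affine_hyperplane H \<and> (\<forall>a\<in>A. H \<inter> closed_segment a (\<gamma> a) \<noteq> {})"
proof -
  have rev: "sgn (det (\<chi> j. homog (a j))) = - sgn (det (\<chi> j. homog (\<gamma> (a j))))"
    if "\<And>j. a j \<in> A" "inj a" for a :: "'d option \<Rightarrow> _"
    using assms(3) that unfolding order_type_reversing_def det_homog_matrix by blast
  \<comment> \<open>The hypothesis covers tuples with distinct entries only, whereas Cauchy-Binet
    sums over all functions; repeated points give equal rows.\<close>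
  have zero: "det (\<chi> j. homog (a j)) = 0" if not_inj: "\<not> inj a" for a :: "'d option \<Rightarrow> real ^ 'd"
  proof -
    obtain i j where "i \<noteq> j" "a i = a j"
      using not_inj by (auto simp: inj_def)
    then show ?thesis
      by (intro det_identical_rows[of i j]) (auto simp: row_def)
  qed
  have opposite_sgn: "s * t \<le> 0" "s \<noteq> 0 \<Longrightarrow> s * t < 0" if "sgn s = - sgn t" for s t :: real
    using that by (auto simp: sgn_if mult_le_0_iff mult_less_0_iff split: if_splits)
  have nonpos: "det (\<chi> j. homog (a j)) * det (\<chi> j. homog (\<gamma> (a j))) \<le> 0"
    if "\<And>j. a j \<in> A" for a :: "'d option \<Rightarrow> _"
    using opposite_sgn(1)[OF rev[of a]] zero[of a] that by (cases "inj a") auto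
  obtain a0 where a0: "\<And>j. a0 j \<in> A" "det (\<chi> j. homog (a0 j)) \<noteq> 0"
    using det_homog_matrix_nonzero[OF assms(1)] unfolding det_homog_matrix by metis
  then have neg: "det (\<chi> j. homog (a0 j)) * det (\<chi> j. homog (\<gamma> (a0 j))) < 0"
    using opposite_sgn(2)[OF rev[of a0]] zero[of a0] by (cases "inj a0") auto
  define C where "C a = {x. (homog a \<bullet> x) * (homog (\<gamma> a) \<bullet> x) \<le> 0}" for a
  have "sphere 0 1 \<inter> \<Inter> (C ` A) \<noteq> {}"
  proof (rule compact_imp_fip_image)
    show "closed (C a)" for a
      unfolding C_def by (intro closed_Collect_le continuous_intros)
    fix I assume I: "finite I" "I \<subseteq> A"
    \<comment> \<open>Adjoining the nondegenerate tuple \<open>a0\<close> to \<open>I\<close>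
      supplies the strictly negative product.\<close>
    obtain x where "norm x = 1" "\<And>a. a \<in> I \<union> range a0 \<Longrightarrow> (homog a \<bullet> x) * (homog (\<gamma> a) \<bullet> x) \<le> 0"
    proof (rule exists_common_nonpos_direction[of "I \<union> range a0" homog "\<lambda>a. homog (\<gamma> a)" a0])
      fix f :: "'d option \<Rightarrow> _"
      assume "\<And>i. f i \<in> I \<union> range a0"
      then have "f i \<in> A" for i
        using I(2) a0(1) by (metis UnE rangeE subsetD)
      then show "det (\<chi> i. homog (f i)) * det (\<chi> i. homog (\<gamma> (f i))) \<le> 0"
        by (rule nonpos)
    qed (use I a0 neg in auto)
    then show "sphere 0 1 \<inter> \<Inter> (C ` I) \<noteq> {}"
      by (auto simp: C_def)
  qed simp
  then obtain x where "x \<in> sphere 0 1 \<inter> \<Inter> (C ` A)"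
    by blast
  then have x: "norm x = 1" "\<And>a. a \<in> A \<Longrightarrow> (homog a \<bullet> x) * (homog (\<gamma> a) \<bullet> x) \<le> 0"
    by (auto simp: C_def)
  define n where "n = (\<chi> i. x $ Some i)"
  define c where "c = - x $ None"
  have opposite: "(n \<bullet> a - c) * (n \<bullet> \<gamma> a - c) \<le> 0" if "a \<in> A" for a
    using x(2)[OF that] by (simp add: inner_homog n_def c_def)
  \<comment> \<open>With \<open>n = 0\<close> the product in \<open>opposite\<close> is the square
    of \<open>c\<close>, which forces \<open>c = 0\<close> and hence \<open>x = 0\<close>, against
    \<open>norm x = 1\<close>.\<close>
  have "n \<noteq> 0"
  proof
    assume "n = 0"
    then have "c = 0"
      using opposite[OF a0(1)] by (auto simp: mult_le_0_iff)
    have "x $ i = 0" for i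
      using \<open>n = 0\<close> \<open>c = 0\<close> by (cases i) (auto simp: n_def c_def vec_eq_iff)
    then have "x = 0"
      by (simp add: vec_eq_iff)
    with x(1) show False by simp
  qed
  then have "affine_hyperplane {z. n \<bullet> z = c}"
    unfolding affine_hyperplane_def by blast
  moreover have "{z. n \<bullet> z = c} \<inter> closed_segment a (\<gamma> a) \<noteq> {}" if "a \<in> A" for a
  proof -
    let ?S = "closed_segment a (\<gamma> a)"
    \<comment> \<open>The endpoints lie weakly on opposite sides, so the connected segment meets the
      hyperplane.\<close>
    from opposite[OF that] consider "n \<bullet> a \<le> c" "c \<le> n \<bullet> \<gamma> a" | "n \<bullet> \<gamma> a \<le> c" "c \<le> n \<bullet> a"
      by (auto simp: mult_le_0_iff)
    then have "\<exists>z\<in>?S. n \<bullet> z = c"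
    proof cases
      case 1
      then show ?thesis
        by (intro connected_ivt_hyperplane[of ?S a "\<gamma> a"]) auto
    next
      case 2
      then show ?thesis
        by (intro connected_ivt_hyperplane[of ?S "\<gamma> a" a]) auto
    qed
    then show ?thesis by blast
  qed
  ultimately show ?thesis by blast
qed

end
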